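(* Let $N\ge s\ge 2$ be integers and let $\{X(1),X(2),\ldots,X(N)\}$ be a centered Gaussian process (i.e. a centered, jointly Gaussian random vector, with arbitrary covariance matrix). Let $F^2(s)$ be the square of the fluctuation function of detrended fluctuation analysis with linear detrending, and let $Y_v(t)$, $v=1,\ldots,[N/s]$, $t=1,\ldots,s$, be the detrended process in segment $v$. Then: a) the expected value of $F^2(s)$ is $$E\left[F^2(s)\right]=\frac{1}{s[N/s]}\sum_{v=1}^{[N/s]}\sum_{j=1}^s E\left[Y_v^2(j)\right];$$ b) the variance of $F^2(s)$ is $$\operatorname{Var}\left[F^2(s)\right]=\frac{2}{s^2[N/s]^2}\sum_{1\le v,u\le [N/s]}\ \sum_{1\le t,w\le s}\Big(E\left[Y_v(t)Y_u(w)\right]\Big)^2 .$$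
   Context: Here $[x]$ denotes the integer part of $x$. The time axis $1,\ldots,N$ is divided into $[N/s]$ consecutive segments of length $s$; put $d_v=(v-1)s$ for $v=1,\ldots,[N/s]$, so segment $v$ consists of the times $1+d_v,\ldots,s+d_v$. In each segment, $p_v(t)=\hat a_v+\hat b_v t$ is the polynomial of degree at most $1$ fitted by ordinary least squares to the data $(t,X(t))$, $t=1+d_v,\ldots,s+d_v$. The detrended process is $$Y_v(t)=X(t+d_v)-p_v(t+d_v),\qquad t=1,\ldots,s,$$ which can be written as $$Y_v(t)=\sum_{i=1}^s X(i+d_v)\,[\delta_{i,t}-P_1(i,t)],\qquad P_1(i,t)=\frac{6i(2t-s-1)+2(s+1)(-3t+2s+1)}{s^3-s},$$ with $\delta_{i,t}$ the Kronecker delta. The squared error sum in segment $v$ is $$f^2(v,s)=\frac1s\sum_{t=1}^s\left[X(t+d_v)-p_v(t+d_v)\right]^2,$$ and the square of the fluctuation function is $$F^2(s)=\frac{1}{[N/s]}\sum_{v=1}^{[N/s]} f^2(v,s).$$ *)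

theory Defs
  imports "HOL-Probability.Probability"
begin

text \<open>Degenerate (almost surely constant) variables count as Gaussian, so that arbitrary
  covariance matrices, including singular ones, are covered.\<close>

definition gaussian_rv :: "'a measure \<Rightarrow> ('a \<Rightarrow> real) \<Rightarrow> bool" where
  "gaussian_rv M Z \<longleftrightarrow> Z \<in> borel_measurable M \<and>
     (\<exists>\<mu>. (AE \<omega> in M. Z \<omega> = \<mu>) \<or>
          (\<exists>\<sigma>>0. distributed M lborel Z (\<lambda>x. ennreal (normal_density \<mu> \<sigma> x))))"

definition jointly_gaussian :: "'a measure \<Rightarrow> 'i set \<Rightarrow> ('i \<Rightarrow> 'a \<Rightarrow> real) \<Rightarrow> bool" where
  "jointly_gaussian M I X \<longleftrightarrow> finite I \<and>
     (\<forall>c :: 'i \<Rightarrow> real. gaussian_rv M (\<lambda>\<omega>. \<Sum>i\<in>I. c i * X i \<omega>))"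

definition centered_gaussian :: "'a measure \<Rightarrow> 'i set \<Rightarrow> ('i \<Rightarrow> 'a \<Rightarrow> real) \<Rightarrow> bool" where
  "centered_gaussian M I X \<longleftrightarrow>
     jointly_gaussian M I X \<and> (\<forall>i\<in>I. prob_space.expectation M (X i) = 0)"

definition seg_offset :: "nat \<Rightarrow> nat \<Rightarrow> nat" where
  "seg_offset s v = (v - 1) * s"

definition segment :: "nat \<Rightarrow> nat \<Rightarrow> nat set" where
  "segment s v = {1 + seg_offset s v..s + seg_offset s v}"

definition ols_coeffs :: "nat set \<Rightarrow> (nat \<Rightarrow> real) \<Rightarrow> real \<times> real" where
  "ols_coeffs T x = arg_min (\<lambda>(a, b). \<Sum>t\<in>T. (x t - (a + b * real t))\<^sup>2) (\<lambda>_. True)"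
  \<comment> \<open>The minimiser exists, and it is unique as soon as \<open>T\<close> has at least two points.\<close>

definition ols_line :: "nat set \<Rightarrow> (nat \<Rightarrow> real) \<Rightarrow> nat \<Rightarrow> real" where
  "ols_line T x t = (case ols_coeffs T x of (a, b) \<Rightarrow> a + b * real t)"

text \<open>In the following, \<open>x\<close> is one sample path of the process and the segment number \<open>v\<close>
  starts at \<open>1\<close>.\<close>

definition detrended :: "nat \<Rightarrow> (nat \<Rightarrow> real) \<Rightarrow> nat \<Rightarrow> nat \<Rightarrow> real" where
  "detrended s x v t =
     x (t + seg_offset s v) - ols_line (segment s v) x (t + seg_offset s v)"

definition sq_error :: "nat \<Rightarrow> (nat \<Rightarrow> real) \<Rightarrow> nat \<Rightarrow> real" where
  "sq_error s x v = 1 / real s *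
     (\<Sum>t=1..s. (x (t + seg_offset s v) - ols_line (segment s v) x (t + seg_offset s v))\<^sup>2)"

definition sq_fluctuation :: "nat \<Rightarrow> nat \<Rightarrow> (nat \<Rightarrow> real) \<Rightarrow> real" where
  "sq_fluctuation N s x = 1 / real (N div s) * (\<Sum>v=1..N div s. sq_error s x v)"

end

theory Submission
  imports Defs
begin

text \<open>Ordinary least squares is linear in the data, so the detrended variables are linear
  combinations of the \<open>X i\<close> and hence again jointly centered Gaussian, and the squared fluctuation
  function is a multiple of the sum of their squares.  The variance of such a sum follows from
  \<open>E[U\<^sup>2 V\<^sup>2] = E[U\<^sup>2] E[V\<^sup>2] + 2 E[U V]\<^sup>2\<close>, which is the polarization of
  \<open>E[W\<^sup>4] = 3 E[W\<^sup>2]\<^sup>2\<close>.\<close>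

section \<open>Linearity of least squares\<close>

text \<open>This is the determinant of the normal equations for a straight line. Multiplied by
  \<open>card T\<close>, it is a sum of squares that vanish only at the mean of \<open>T\<close>,
  and two distinct points cannot both be the mean.\<close>

lemma gram_det_pos:
  fixes T :: "nat set"
  assumes "finite T" and "i \<in> T" and "j \<in> T" and "i \<noteq> j"
  shows "0 < real (card T) * (\<Sum>t\<in>T. (real t)\<^sup>2) - (\<Sum>t\<in>T. real t)\<^sup>2"
proof -
  define n p q where "n = real (card T)" and "p = (\<Sum>t\<in>T. real t)" and "q = (\<Sum>t\<in>T. (real t)\<^sup>2)"
  have "n > 0"
    using assms by (auto simp: n_def card_gt_0_iff)
  have "0 < (n * real i - p)\<^sup>2 + (n * real j - p)\<^sup>2"
    using \<open>n > 0\<close> \<open>i \<noteq> j\<close> by (auto simp: sum_power2_gt_zero_iff)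
  also have "\<dots> = (\<Sum>t\<in>{i, j}. (n * real t - p)\<^sup>2)"
    using \<open>i \<noteq> j\<close> by simp
  also have "\<dots> \<le> (\<Sum>t\<in>T. (n * real t - p)\<^sup>2)"
    using assms by (intro sum_mono2) auto
  also have "\<dots> = (\<Sum>t\<in>T. n\<^sup>2 * (real t)\<^sup>2 - 2 * n * p * real t + p\<^sup>2)"
    by (intro sum.cong refl) (simp add: power2_eq_square algebra_simps)
  also have "\<dots> = n\<^sup>2 * q - 2 * n * p * p + n * p\<^sup>2"
    by (simp add: sum.distrib sum_subtractf sum_distrib_left[symmetric] n_def p_def q_def)
  also have "\<dots> = n * (n * q - p\<^sup>2)"
    by (simp add: power2_eq_square algebra_simps)
  finally show ?thesis
    using \<open>n > 0\<close> by (simp add: zero_less_mult_iff n_def p_def q_def)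
qed

text \<open>\<open>r0\<close> and \<open>r1\<close> are the normal equations: the residual is
  orthogonal to the constants and to the identity. They make (a, b) a minimiser. Since
  \<open>arg_min\<close> merely selects some minimiser, uniqueness is also required, and this is
  what the two distinct points supply.\<close>

lemma ols_coeffs_eqI:
  assumes "finite T" and "i \<in> T" and "j \<in> T" and "i \<noteq> j"
    and r0: "(\<Sum>t\<in>T. x t - (a + b * real t)) = 0"
    and r1: "(\<Sum>t\<in>T. (x t - (a + b * real t)) * real t) = 0"
  shows "ols_coeffs T x = (a, b)"
proof -
  define Q where "Q = (\<lambda>(a, b). \<Sum>t\<in>T. (x t - (a + b * real t))\<^sup>2)"
  \<comment> \<open>Pythagoras: the cross terms vanish by the normal equations.\<close>
  have Q: "Q (a', b') = Q (a, b) + (\<Sum>t\<in>T. ((a - a') + (b - b') * real t)\<^sup>2)" for a' b'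
  proof -
    have "Q (a', b') = (\<Sum>t\<in>T. (x t - (a + b * real t))\<^sup>2 + ((a - a') + (b - b') * real t)\<^sup>2
       + (2 * (a - a') * (x t - (a + b * real t)) + 2 * (b - b') * ((x t - (a + b * real t)) * real t)))"
      unfolding Q_def prod.case by (intro sum.cong refl) algebra
    also have "\<dots> = Q (a, b) + (\<Sum>t\<in>T. ((a - a') + (b - b') * real t)\<^sup>2)"
      unfolding sum.distrib sum_distrib_left[symmetric] r0 r1 by (simp add: Q_def)
    finally show ?thesis .
  qed
  obtain a' b' where ab': "ols_coeffs T x = (a', b')"
    by (cases "ols_coeffs T x")
  have "Q (a, b) \<le> Q y" for y
    using Q[of "fst y" "snd y"] by (simp add: sum_nonneg)
  then have "Q (arg_min Q (\<lambda>_. True)) = Q (a, b)"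
    by (intro arg_min_equality) auto
  then have "Q (a', b') = Q (a, b)"
    using ab' by (simp add: ols_coeffs_def Q_def)
  then have "(\<Sum>t\<in>T. ((a - a') + (b - b') * real t)\<^sup>2) = 0"
    using Q[of a' b'] by simp
  \<comment> \<open>The two lines agree on all of \<open>T\<close>; an affine function with two
    distinct zeros has zero coefficients.\<close>
  then have "\<forall>t\<in>T. (a - a') + (b - b') * real t = 0"
    using \<open>finite T\<close> by (simp add: sum_nonneg_eq_0_iff)
  then have i: "(a - a') + (b - b') * real i = 0" and j: "(a - a') + (b - b') * real j = 0"
    using assms by auto
  then have "(b - b') * (real i - real j) = 0"
    by (simp add: algebra_simps)
  then have "b = b'"
    using \<open>i \<noteq> j\<close> by simp
  with i ab' show ?thesis
    by simp
qed

text \<open>Cramer's rule solves the normal equations with right-hand sides that are linear in the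
  data. The weights depend on \<open>T\<close> and \<open>t\<close> but not on \<open>x\<close>, so
  the same weights serve every sample path.\<close>

lemma ols_line_linear:
  assumes "finite T" and "i \<in> T" and "j \<in> T" and "i \<noteq> j"
  obtains c where "\<And>x. ols_line T x t = (\<Sum>k\<in>T. c k * x k)"
proof
  define n p q where "n = real (card T)" and "p = (\<Sum>t\<in>T. real t)" and "q = (\<Sum>t\<in>T. (real t)\<^sup>2)"
  define D where "D = n * q - p\<^sup>2"
  have D: "D \<noteq> 0"
    using gram_det_pos[OF assms] by (simp add: D_def n_def p_def q_def)
  \<comment> \<open>The factor of \<open>x k\<close> in \<open>a + b * real t\<close>, with
    \<open>a\<close> and \<open>b\<close> given by Cramer's rule below.\<close>
  define c where "c = (\<lambda>k. (q - p * real k) / D + (n * real k - p) / D * real t)"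
  fix x :: "nat \<Rightarrow> real"
  define y z where "y = (\<Sum>k\<in>T. x k)" and "z = (\<Sum>k\<in>T. x k * real k)"
  define a b where "a = (q * y - p * z) / D" and "b = (n * z - p * y) / D"
  \<comment> \<open>\<open>D\<close> stays folded until the denominators are cancelled; unfolding it
    then leaves polynomial identities.\<close>
  have "D * (y - (a * n + b * p)) = 0" "D * (z - (a * p + b * q)) = 0"
    using D by (simp_all add: a_def b_def right_diff_distrib distrib_left)
      (simp_all add: D_def power2_eq_square algebra_simps)
  then have ne: "y = a * n + b * p" "z = a * p + b * q"
    using D by simp_all
  have "(\<Sum>t\<in>T. x t - (a + b * real t)) = y - (a * n + b * p)"
    by (simp add: sum_subtractf sum.distrib sum_distrib_left[symmetric] y_def n_def p_def)
  moreover have "(\<Sum>t\<in>T. (x t - (a + b * real t)) * real t) = z - (a * p + b * q)"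
    by (simp add: left_diff_distrib distrib_right power2_eq_square[symmetric] mult.assoc
        sum_subtractf sum.distrib sum_distrib_left[symmetric] z_def p_def q_def)
  ultimately have "ols_coeffs T x = (a, b)"
    using ne by (intro ols_coeffs_eqI[OF assms]) simp_all
  then have "ols_line T x t = a + b * real t"
    by (simp add: ols_line_def)
  also have "\<dots> = (\<Sum>k\<in>T. q / D * x k - p / D * (x k * real k)
      + real t * (n / D * (x k * real k) - p / D * x k))"
    unfolding sum.distrib sum_subtractf sum_distrib_left[symmetric] y_def[symmetric] z_def[symmetric]
    by (simp add: a_def b_def diff_divide_distrib)
  also have "\<dots> = (\<Sum>k\<in>T. c k * x k)"
    by (intro sum.cong refl) (simp add: c_def diff_divide_distrib algebra_simps)
  finally show "ols_line T x t = (\<Sum>k\<in>T. c k * x k)" .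
qed

text \<open>The weights are extended by zero from the segment to \<open>{1..N}\<close>. Values from
  different segments thus become combinations of one and the same Gaussian vector, which makes them
  jointly Gaussian.\<close>

lemma detrended_linear:
  assumes "2 \<le> s" and "v \<in> {1..N div s}" and "t \<in> {1..s}"
  obtains c where "\<And>x. detrended s x v t = (\<Sum>i=1..N. c i * x i)"
proof -
  let ?d = "seg_offset s v"
  \<comment> \<open>The last time of the segment. The case v = 0 must be excluded because of the
    truncated subtraction in \<open>seg_offset\<close>.\<close>
  have "s + ?d = v * s"
    using assms by (cases v) (auto simp: seg_offset_def)
  also have "\<dots> \<le> N"
    using assms by (metis atLeastAtMost_iff div_times_less_eq_dividend le_trans mult_le_mono1)
  finally have sub: "segment s v \<subseteq> {1..N}" and t: "t + ?d \<in> {1..N}"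
    using assms by (auto simp: segment_def)
  \<comment> \<open>Since s is at least 2, the first two times of the segment serve as the two
    distinct points.\<close>
  obtain c where c: "\<And>x. ols_line (segment s v) x (t + ?d) = (\<Sum>k\<in>segment s v. c k * x k)"
    using ols_line_linear[of "segment s v" "1 + ?d" "2 + ?d" "t + ?d"] assms
    by (auto simp: segment_def)
  have "detrended s x v t
      = (\<Sum>i=1..N. ((if i = t + ?d then 1 else 0) - (if i \<in> segment s v then c i else 0)) * x i)" for x
  proof -
    have "(\<Sum>k\<in>segment s v. c k * x k) = (\<Sum>i=1..N. if i \<in> segment s v then c i * x i else 0)"
      using sub by (simp add: sum.inter_restrict[symmetric] Int_absorb1)
    moreover have "x (t + ?d) = (\<Sum>i=1..N. if i = t + ?d then x i else 0)"
      using t by (simp add: sum.delta)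
    ultimately show ?thesis
      unfolding detrended_def c left_diff_distrib sum_subtractf
      by (simp add: if_distrib[of "\<lambda>y. y * _"] cong: if_cong)
  qed
  then show ?thesis
    by (rule that)
qed

section \<open>Moments of centered Gaussian variables\<close>

context prob_space
begin

text \<open>A non-integrable function has integral 0 by convention, so a zero expectation does not
  yield the integrability that linearity of expectation requires.\<close>

lemma gaussian_rv_integrable:
  assumes "gaussian_rv M W"
  shows "integrable M W"
proof -
  have [measurable]: "W \<in> borel_measurable M"
    using assms by (simp add: gaussian_rv_def)
  from assms consider \<mu> where "AE \<omega> in M. W \<omega> = \<mu>"
    | \<mu> \<sigma> where "\<sigma> > 0" "distributed M lborel W (\<lambda>x. ennreal (normal_density \<mu> \<sigma> x))"
    by (auto simp: gaussian_rv_def)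
  then show ?thesis
  proof cases
    case 1
    then show ?thesis
      using integrable_cong_AE[of W M "\<lambda>_. \<mu>"] by simp
  next
    case 2
    then show ?thesis
      using integrable_normal_moment_nz_1[of \<sigma> \<mu>]
        distributed_integrable[OF 2(2), of "\<lambda>x. x"] by simp
  qed
qed

lemma gaussian_rv_centered_moments:
  assumes "gaussian_rv M W" and "expectation W = 0"
  shows "integrable M (\<lambda>\<omega>. W \<omega> ^ 2)" and "integrable M (\<lambda>\<omega>. W \<omega> ^ 4)"
    and "expectation (\<lambda>\<omega>. W \<omega> ^ 4) = 3 * (expectation (\<lambda>\<omega>. W \<omega> ^ 2))\<^sup>2"
proof -
  have [measurable]: "W \<in> borel_measurable M"
    using assms by (simp add: gaussian_rv_def)
  from assms consider \<mu> where "AE \<omega> in M. W \<omega> = \<mu>"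
    | \<mu> \<sigma> where "\<sigma> > 0" "distributed M lborel W (\<lambda>x. ennreal (normal_density \<mu> \<sigma> x))"
    by (auto simp: gaussian_rv_def)
  then have "integrable M (\<lambda>\<omega>. W \<omega> ^ 2) \<and> integrable M (\<lambda>\<omega>. W \<omega> ^ 4)
    \<and> expectation (\<lambda>\<omega>. W \<omega> ^ 4) = 3 * (expectation (\<lambda>\<omega>. W \<omega> ^ 2))\<^sup>2"
  proof cases
    case 1
    \<comment> \<open>In the degenerate case the mean is the constant itself, so W is almost surely
      0 and both sides of the moment identity vanish.\<close>
    then have "expectation W = \<mu>"
      using integral_cong_AE[of W M "\<lambda>_. \<mu>"] by (simp add: prob_space)
    with 1 assms have ae: "AE \<omega> in M. W \<omega> = 0"
      by simp
    then have "AE \<omega> in M. W \<omega> ^ k = 0" if "k > 0" for k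
      using that by (auto elim: eventually_mono)
    then have "integrable M (\<lambda>\<omega>. W \<omega> ^ k) \<and> expectation (\<lambda>\<omega>. W \<omega> ^ k) = 0" if "k > 0" for k
      using that integrable_cong_AE[of "\<lambda>\<omega>. W \<omega> ^ k" M "\<lambda>_. 0"]
        integral_cong_AE[of "\<lambda>\<omega>. W \<omega> ^ k" M "\<lambda>_. 0"] by simp
    then show ?thesis
      by simp
  next
    case 2
    then have "\<mu> = 0"
      using assms normal_distributed_expectation[of \<sigma> W \<mu>] by simp
    note d = 2(2)[unfolded \<open>\<mu> = 0\<close>]
    \<comment> \<open>The general even moment of a normal variable: k = 1 gives \<sigma>^2 and k = 2
      gives 3 \<sigma>^4.\<close>
    have "integrable M (\<lambda>\<omega>. W \<omega> ^ (2 * k))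
      \<and> expectation (\<lambda>\<omega>. W \<omega> ^ (2 * k)) = fact (2 * k) / ((2 / \<sigma>\<^sup>2) ^ k * fact k)" for k
      using normal_moment_even[OF 2(1), of 0 k]
        distributed_integrable[OF d, of "\<lambda>x. x ^ (2 * k)"]
        distributed_integral[OF d, of "\<lambda>x. x ^ (2 * k)"]
      by (simp add: has_bochner_integral_iff)
    from this[of 1] this[of 2] show ?thesis
      by (simp add: fact_numeral power_divide power2_eq_square)
  qed
  then show "integrable M (\<lambda>\<omega>. W \<omega> ^ 2)" and "integrable M (\<lambda>\<omega>. W \<omega> ^ 4)"
    and "expectation (\<lambda>\<omega>. W \<omega> ^ 4) = 3 * (expectation (\<lambda>\<omega>. W \<omega> ^ 2))\<^sup>2"
    by blast+
qed

text \<open>Isserlis' formula for two variables. The assumption on all combinations also admits U =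
  V and singular covariances, so diagonal terms need no separate treatment.\<close>

lemma gaussian_pair_moments:
  assumes gauss: "\<And>a b. gaussian_rv M (\<lambda>\<omega>. a * U \<omega> + b * V \<omega>)"
    and U: "expectation U = 0" and V: "expectation V = 0"
  shows "integrable M (\<lambda>\<omega>. U \<omega> * V \<omega>)"
    and "integrable M (\<lambda>\<omega>. (U \<omega>)\<^sup>2 * (V \<omega>)\<^sup>2)"
    and "expectation (\<lambda>\<omega>. (U \<omega>)\<^sup>2 * (V \<omega>)\<^sup>2)
      = expectation (\<lambda>\<omega>. (U \<omega>)\<^sup>2) * expectation (\<lambda>\<omega>. (V \<omega>)\<^sup>2)
        + 2 * (expectation (\<lambda>\<omega>. U \<omega> * V \<omega>))\<^sup>2"
proof -
  have int: "integrable M U" "integrable M V"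
    using gaussian_rv_integrable[OF gauss[of 1 0]] gaussian_rv_integrable[OF gauss[of 0 1]] by simp_all
  have "expectation (\<lambda>\<omega>. a * U \<omega> + b * V \<omega>) = 0" for a b
    using int U V by simp
  note mom = gaussian_rv_centered_moments[OF gauss this]
  \<comment> \<open>The moments of U, V, U + V and U - V are the ones that polarization
    uses.\<close>
  note u = mom[of 1 0, simplified] and v = mom[of 0 1, simplified]
  note p = mom[of 1 1, simplified] and m = mom[of 1 "-1", simplified]
  have UV: "U \<omega> * V \<omega> = (1/4) * ((U \<omega> + V \<omega>)\<^sup>2 - (U \<omega> - V \<omega>)\<^sup>2)" for \<omega>
    by (simp add: power2_eq_square algebra_simps)
  show 1: "integrable M (\<lambda>\<omega>. U \<omega> * V \<omega>)"
    unfolding UV using p(1) m(1) by simp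
  \<comment> \<open>Adding the two fourth powers cancels the odd mixed terms and leaves 2 U^4 + 12
    U^2 V^2 + 2 V^4. The identity also carries integrability over to the product.\<close>
  have U2V2: "(U \<omega>)\<^sup>2 * (V \<omega>)\<^sup>2
      = (1/12) * ((U \<omega> + V \<omega>) ^ 4 + (U \<omega> - V \<omega>) ^ 4 - 2 * U \<omega> ^ 4 - 2 * V \<omega> ^ 4)" for \<omega>
    by (simp add: power2_eq_square power4_eq_xxxx algebra_simps)
  show "integrable M (\<lambda>\<omega>. (U \<omega>)\<^sup>2 * (V \<omega>)\<^sup>2)"
    unfolding U2V2 using p(2) m(2) u(2) v(2) by simp
  have P: "expectation (\<lambda>\<omega>. (U \<omega> + V \<omega>)\<^sup>2) = expectation (\<lambda>\<omega>. (U \<omega>)\<^sup>2)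
      + 2 * expectation (\<lambda>\<omega>. U \<omega> * V \<omega>) + expectation (\<lambda>\<omega>. (V \<omega>)\<^sup>2)"
    using u(1) v(1) 1 by (simp add: power2_sum mult.assoc)
  have N: "expectation (\<lambda>\<omega>. (U \<omega> - V \<omega>)\<^sup>2) = expectation (\<lambda>\<omega>. (U \<omega>)\<^sup>2)
      - 2 * expectation (\<lambda>\<omega>. U \<omega> * V \<omega>) + expectation (\<lambda>\<omega>. (V \<omega>)\<^sup>2)"
    using u(1) v(1) 1 by (simp add: power2_diff mult.assoc)
  have "expectation (\<lambda>\<omega>. (U \<omega>)\<^sup>2 * (V \<omega>)\<^sup>2)
      = (1/12) * (expectation (\<lambda>\<omega>. (U \<omega> + V \<omega>) ^ 4) + expectation (\<lambda>\<omega>. (U \<omega> - V \<omega>) ^ 4)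
          - 2 * expectation (\<lambda>\<omega>. U \<omega> ^ 4) - 2 * expectation (\<lambda>\<omega>. V \<omega> ^ 4))"
    unfolding U2V2 using p(2) m(2) u(2) v(2) by simp
  \<comment> \<open>With A = E[U^2], B = E[V^2], C = E[U V], the fourth moments of U + V and U - V
    are 3 (A + B + 2 C)^2 and 3 (A + B - 2 C)^2; the bracket collapses to 12 A B + 24 C^2.\<close>
  also have "\<dots> = expectation (\<lambda>\<omega>. (U \<omega>)\<^sup>2) * expectation (\<lambda>\<omega>. (V \<omega>)\<^sup>2)
        + 2 * (expectation (\<lambda>\<omega>. U \<omega> * V \<omega>))\<^sup>2"
    unfolding p(3) m(3) u(3) v(3) P N by (simp add: power2_eq_square algebra_simps)
  finally show "expectation (\<lambda>\<omega>. (U \<omega>)\<^sup>2 * (V \<omega>)\<^sup>2)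
      = expectation (\<lambda>\<omega>. (U \<omega>)\<^sup>2) * expectation (\<lambda>\<omega>. (V \<omega>)\<^sup>2)
        + 2 * (expectation (\<lambda>\<omega>. U \<omega> * V \<omega>))\<^sup>2" .
qed

text \<open>Expanding the square of the sum and applying Isserlis' formula to each pair, the
  products of second moments add up to the squared mean and cancel in the variance. Pairwise
  Gaussianity suffices because each term involves two variables.\<close>

lemma variance_sum_squares:
  assumes "finite K"
    and gauss: "\<And>k l a b. k \<in> K \<Longrightarrow> l \<in> K \<Longrightarrow> gaussian_rv M (\<lambda>\<omega>. a * Y k \<omega> + b * Y l \<omega>)"
    and cent: "\<And>k. k \<in> K \<Longrightarrow> expectation (Y k) = 0"
  shows "variance (\<lambda>\<omega>. \<Sum>k\<in>K. (Y k \<omega>)\<^sup>2)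
    = 2 * (\<Sum>k\<in>K. \<Sum>l\<in>K. (expectation (\<lambda>\<omega>. Y k \<omega> * Y l \<omega>))\<^sup>2)"
proof -
  let ?E = "\<lambda>k. expectation (\<lambda>\<omega>. (Y k \<omega>)\<^sup>2)"
  note m = gaussian_pair_moments[OF gauss cent cent]
  have sq: "(\<Sum>k\<in>K. (Y k \<omega>)\<^sup>2)\<^sup>2 = (\<Sum>k\<in>K. \<Sum>l\<in>K. (Y k \<omega>)\<^sup>2 * (Y l \<omega>)\<^sup>2)" for \<omega>
    by (simp add: power2_eq_square[of "sum _ _"] sum_product)
  \<comment> \<open>The diagonal case of the product integrability.\<close>
  have int: "integrable M (\<lambda>\<omega>. (Y k \<omega>)\<^sup>2)" if "k \<in> K" for k
    using m(1)[OF that that that that] by (simp add: power2_eq_square)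
  have "integrable M (\<lambda>\<omega>. (\<Sum>k\<in>K. (Y k \<omega>)\<^sup>2)\<^sup>2)"
    unfolding sq by (intro Bochner_Integration.integrable_sum m)
  moreover have "integrable M (\<lambda>\<omega>. \<Sum>k\<in>K. (Y k \<omega>)\<^sup>2)"
    by (intro Bochner_Integration.integrable_sum int)
  moreover have "expectation (\<lambda>\<omega>. \<Sum>k\<in>K. (Y k \<omega>)\<^sup>2) = (\<Sum>k\<in>K. ?E k)"
    using int by (simp add: Bochner_Integration.integral_sum)
  ultimately have "variance (\<lambda>\<omega>. \<Sum>k\<in>K. (Y k \<omega>)\<^sup>2)
      = expectation (\<lambda>\<omega>. (\<Sum>k\<in>K. (Y k \<omega>)\<^sup>2)\<^sup>2) - (\<Sum>k\<in>K. ?E k)\<^sup>2"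
    by (metis variance_eq)
  also have "expectation (\<lambda>\<omega>. (\<Sum>k\<in>K. (Y k \<omega>)\<^sup>2)\<^sup>2)
      = (\<Sum>k\<in>K. \<Sum>l\<in>K. expectation (\<lambda>\<omega>. (Y k \<omega>)\<^sup>2 * (Y l \<omega>)\<^sup>2))"
    unfolding sq using m(2)
    by (subst Bochner_Integration.integral_sum;
        (intro Bochner_Integration.integrable_sum sum.cong refl Bochner_Integration.integral_sum)?) auto
  also have "\<dots> = (\<Sum>k\<in>K. \<Sum>l\<in>K. ?E k * ?E l + 2 * (expectation (\<lambda>\<omega>. Y k \<omega> * Y l \<omega>))\<^sup>2)"
    by (intro sum.cong refl m(3))
  also have "\<dots> = (\<Sum>k\<in>K. ?E k)\<^sup>2 + 2 * (\<Sum>k\<in>K. \<Sum>l\<in>K. (expectation (\<lambda>\<omega>. Y k \<omega> * Y l \<omega>))\<^sup>2)"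
    by (simp only: sum.distrib sum_distrib_left[symmetric] power2_eq_square[of "sum _ _"] sum_product)
  finally show ?thesis
    by simp
qed

end

section \<open>Mean and variance of the squared fluctuation function\<close>

lemma sq_fluctuation_eq:
  "sq_fluctuation N s x
    = 1 / (real s * real (N div s)) * (\<Sum>k\<in>{1..N div s} \<times> {1..s}. (detrended s x (fst k) (snd k))\<^sup>2)"
proof -
  have "(\<Sum>v=1..N div s. sq_error s x v) = 1 / real s * (\<Sum>v=1..N div s. \<Sum>t=1..s. (detrended s x v t)\<^sup>2)"
    unfolding sq_error_def detrended_def sum_distrib_left ..
  then show ?thesis
    by (simp add: sq_fluctuation_def sum.cartesian_product split_beta)
qed

theorem theorem2p2:
  fixes M :: "'a measure" and X :: "nat \<Rightarrow> 'a \<Rightarrow> real" and N s :: nat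
  assumes "prob_space M"
    and "2 \<le> s" and "s \<le> N"
    and "centered_gaussian M {1..N} X"
  shows "prob_space.expectation M (\<lambda>\<omega>. sq_fluctuation N s (\<lambda>i. X i \<omega>)) =
           1 / (real s * real (N div s)) *
             (\<Sum>v=1..N div s. \<Sum>j=1..s.
                prob_space.expectation M (\<lambda>\<omega>. (detrended s (\<lambda>i. X i \<omega>) v j)\<^sup>2)) \<and>
         prob_space.variance M (\<lambda>\<omega>. sq_fluctuation N s (\<lambda>i. X i \<omega>)) =
           2 / ((real s)\<^sup>2 * (real (N div s))\<^sup>2) *
             (\<Sum>v=1..N div s. \<Sum>u=1..N div s. \<Sum>t=1..s. \<Sum>w=1..s.
                (prob_space.expectation M
                   (\<lambda>\<omega>. detrended s (\<lambda>i. X i \<omega>) v t * detrended s (\<lambda>i. X i \<omega>) u w))\<^sup>2)"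
proof -
  interpret prob_space M
    by fact
  define K where "K = {1..N div s} \<times> {1..s}"
  define Y where "Y = (\<lambda>k \<omega>. detrended s (\<lambda>i. X i \<omega>) (fst k) (snd k))"
  have "finite K"
    by (simp add: K_def)
  have sum_K: "(\<Sum>k\<in>K. f k) = (\<Sum>v=1..N div s. \<Sum>t=1..s. f (v, t))" for f :: "nat \<times> nat \<Rightarrow> real"
    by (simp add: K_def sum.cartesian_product split_beta)
  have gauss: "gaussian_rv M (\<lambda>\<omega>. \<Sum>i=1..N. c i * X i \<omega>)" for c
    using assms by (simp add: centered_gaussian_def jointly_gaussian_def)
  have X: "integrable M (X i)" "expectation (X i) = 0" if "i \<in> {1..N}" for i
  proof -
    \<comment> \<open>\<open>jointly_gaussian\<close> speaks of linear combinations, so a single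
      \<open>X i\<close> is recovered with a unit coefficient vector.\<close>
    have "(\<lambda>\<omega>. \<Sum>j=1..N. (if j = i then 1 else 0) * X j \<omega>) = X i"
      using that by (auto simp: if_distrib[of "\<lambda>y. y * _"] cong: if_cong)
    then show "integrable M (X i)"
      using gaussian_rv_integrable[OF gauss[of "\<lambda>j. if j = i then 1 else 0"]] by metis
    show "expectation (X i) = 0"
      using assms that by (simp add: centered_gaussian_def)
  qed
  \<comment> \<open>One coefficient vector must work for all \<omega>: only deterministic weights
    preserve Gaussianity.\<close>
  have lin: "\<exists>c. \<forall>\<omega>. Y k \<omega> = (\<Sum>i=1..N. c i * X i \<omega>)" if k: "k \<in> K" for k
  proof -
    have "fst k \<in> {1..N div s}" "snd k \<in> {1..s}"
      using k by (auto simp: K_def)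
    from detrended_linear[OF \<open>2 \<le> s\<close> this] obtain c
      where "\<And>x. detrended s x (fst k) (snd k) = (\<Sum>i=1..N. c i * x i)"
      by blast
    then show ?thesis
      unfolding Y_def by blast
  qed
  then obtain c where c: "Y k \<omega> = (\<Sum>i=1..N. c k i * X i \<omega>)" if "k \<in> K" for k \<omega>
    by metis
  have gaussY: "gaussian_rv M (\<lambda>\<omega>. a * Y k \<omega> + b * Y l \<omega>)" if "k \<in> K" "l \<in> K" for k l a b
  proof -
    have "(\<lambda>\<omega>. a * Y k \<omega> + b * Y l \<omega>) = (\<lambda>\<omega>. \<Sum>i=1..N. (a * c k i + b * c l i) * X i \<omega>)"
      using that by (simp add: c sum_distrib_left sum.distrib distrib_right mult.assoc)
    then show ?thesis
      using gauss by simp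
  qed
  have centY: "expectation (Y k) = 0" if "k \<in> K" for k
  proof -
    have "Y k = (\<lambda>\<omega>. \<Sum>i=1..N. c k i * X i \<omega>)"
      using c[OF that] by blast
    then show ?thesis
      using X by (simp add: Bochner_Integration.integral_sum)
  qed
  have intY: "integrable M (\<lambda>\<omega>. (Y k \<omega>)\<^sup>2)" if "k \<in> K" for k
    using gaussian_pair_moments(1)[OF gaussY centY centY] that by (simp add: power2_eq_square)
  define C where "C = 1 / (real s * real (N div s))"
  have F: "sq_fluctuation N s (\<lambda>i. X i \<omega>) = C * (\<Sum>k\<in>K. (Y k \<omega>)\<^sup>2)" for \<omega>
    by (simp add: sq_fluctuation_eq C_def K_def Y_def)
  have "expectation (\<lambda>\<omega>. sq_fluctuation N s (\<lambda>i. X i \<omega>)) = C * (\<Sum>k\<in>K. expectation (\<lambda>\<omega>. (Y k \<omega>)\<^sup>2))"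
    unfolding F using intY by (simp add: Bochner_Integration.integral_sum)
  also have "(\<Sum>k\<in>K. expectation (\<lambda>\<omega>. (Y k \<omega>)\<^sup>2))
      = (\<Sum>v=1..N div s. \<Sum>j=1..s. expectation (\<lambda>\<omega>. (detrended s (\<lambda>i. X i \<omega>) v j)\<^sup>2))"
    by (simp only: sum_K Y_def fst_conv snd_conv)
  finally have A: "expectation (\<lambda>\<omega>. sq_fluctuation N s (\<lambda>i. X i \<omega>))
      = C * (\<Sum>v=1..N div s. \<Sum>j=1..s. expectation (\<lambda>\<omega>. (detrended s (\<lambda>i. X i \<omega>) v j)\<^sup>2))" .
  have "variance (\<lambda>\<omega>. sq_fluctuation N s (\<lambda>i. X i \<omega>)) = C\<^sup>2 * variance (\<lambda>\<omega>. \<Sum>k\<in>K. (Y k \<omega>)\<^sup>2)"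
    unfolding F by (simp add: right_diff_distrib[symmetric] power_mult_distrib)
  also have "\<dots> = 2 * C\<^sup>2 * (\<Sum>k\<in>K. \<Sum>l\<in>K. (expectation (\<lambda>\<omega>. Y k \<omega> * Y l \<omega>))\<^sup>2)"
    using variance_sum_squares[OF \<open>finite K\<close> gaussY centY] by simp
  also have "(\<Sum>k\<in>K. \<Sum>l\<in>K. (expectation (\<lambda>\<omega>. Y k \<omega> * Y l \<omega>))\<^sup>2)
      = (\<Sum>v=1..N div s. \<Sum>t=1..s. \<Sum>u=1..N div s. \<Sum>w=1..s.
          (expectation (\<lambda>\<omega>. detrended s (\<lambda>i. X i \<omega>) v t * detrended s (\<lambda>i. X i \<omega>) u w))\<^sup>2)"
    by (simp only: sum_K Y_def fst_conv snd_conv)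
  \<comment> \<open>Summing over pairs of indices yields the order v, t, u, w; exchanging the two
    middle sums gives the stated order.\<close>
  also have "\<dots> = (\<Sum>v=1..N div s. \<Sum>u=1..N div s. \<Sum>t=1..s. \<Sum>w=1..s.
          (expectation (\<lambda>\<omega>. detrended s (\<lambda>i. X i \<omega>) v t * detrended s (\<lambda>i. X i \<omega>) u w))\<^sup>2)"
    by (intro sum.cong refl sum.swap)
  also have "2 * C\<^sup>2 = 2 / ((real s)\<^sup>2 * (real (N div s))\<^sup>2)"
    by (simp add: C_def power_divide power_mult_distrib)
  finally show ?thesis
    using A by (simp only: C_def)
qed

end
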